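(* Consider the multinomial model with $m>1$ cells and sample size $n$, with a symmetric Dirichlet$(a,\dots,a)$ prior on the cell probabilities, and let $\pi^R(a)$, $a>0$, be the reference (Jeffreys) prior for the hyperparameter $a$ in the resulting marginal model, that is, $$\pi^R(a)\propto\left[\sum_{j=0}^{n-1}\left(\frac{Q(j\mid a,m,n)}{(a+j)^2}-\frac{m}{(ma+j)^2}\right)\right]^{1/2},$$ where $$Q(j\mid a,m,n)=\sum_{l=j+1}^n p(l\mid a,m,n),\qquad p(l\mid a,m,n)=\binom{n}{l}\frac{\Gamma(l+a)\,\Gamma(n-l+(m-1)a)\,\Gamma(ma)}{\Gamma(a)\,\Gamma((m-1)a)\,\Gamma(n+ma)}.$$ Then $\pi^R(a)$ is a proper prior (i.e. it is integrable over $(0,\infty)$).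
   Context: The marginal model, obtained by integrating the multinomial likelihood against the Dirichlet$(a,\dots,a)$ prior, is $$p(\mathbf{x}\mid a)=\frac{n!}{x_1!\cdots x_m!}\,\frac{\Gamma(ma)}{\Gamma(a)^m}\,\frac{\prod_{i=1}^m\Gamma(x_i+a)}{\Gamma(n+ma)},\qquad x_i\in\{0,1,2,\dots\},\ \sum_{i=1}^m x_i=n.$$ The reference (Jeffreys) prior is proportional to the square root of the Fisher information for $a$ in this model. The function $p(l\mid a,m,n)$ is the marginal probability that a given cell count equals $l$, and $Q(\cdot\mid a,m,n)$ is its right tail. *)

theory Defs
  imports "HOL-Analysis.Analysis"
begin

definition cell_counts :: "nat \<Rightarrow> nat \<Rightarrow> (nat \<Rightarrow> nat) set" where
  "cell_counts m n = {x \<in> {..<m} \<rightarrow>\<^sub>E UNIV. (\<Sum>i<m. x i) = n}"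

text \<open>The multinomial likelihood integrated against the symmetric Dirichlet prior with
  parameter \<open>a\<close> on the \<open>m\<close> cell probabilities.\<close>

definition marginal_model :: "nat \<Rightarrow> nat \<Rightarrow> (nat \<Rightarrow> nat) \<Rightarrow> real \<Rightarrow> real" where
  "marginal_model m n x a =
     fact n / (\<Prod>i<m. fact (x i)) * (Gamma (real m * a) / Gamma a ^ m)
       * ((\<Prod>i<m. Gamma (real (x i) + a)) / Gamma (real n + real m * a))"

text \<open>Fisher information at \<open>a\<close> of a one-parameter family of mass functions \<open>f x a\<close> on a
  finite sample space \<open>X\<close>: the expectation of the squared score.\<close>

definition fisher_information :: "'x set \<Rightarrow> ('x \<Rightarrow> real \<Rightarrow> real) \<Rightarrow> real \<Rightarrow> real" where
  "fisher_information X f a = (\<Sum>x\<in>X. f x a * (deriv (\<lambda>b. ln (f x b)) a)\<^sup>2)"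

text \<open>Priors on \<open>a > 0\<close> are determined only up to a positive constant, and values of the
  density at \<open>a \<le> 0\<close> are irrelevant.\<close>

definition proportional_prior :: "(real \<Rightarrow> real) \<Rightarrow> (real \<Rightarrow> real) \<Rightarrow> bool" where
  "proportional_prior p q \<longleftrightarrow> (\<exists>c>0. \<forall>a>0. p a = c * q a)"

definition jeffreys_prior :: "nat \<Rightarrow> nat \<Rightarrow> (real \<Rightarrow> real) \<Rightarrow> bool" where
  "jeffreys_prior m n p \<longleftrightarrow>
     proportional_prior p (\<lambda>a. sqrt (fisher_information (cell_counts m n) (marginal_model m n) a))"

definition cell_prob :: "nat \<Rightarrow> real \<Rightarrow> nat \<Rightarrow> nat \<Rightarrow> real" where
  "cell_prob l a m n =
     real (n choose l) * (Gamma (real l + a) * Gamma (real n - real l + (real m - 1) * a) * Gamma (real m * a))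
       / (Gamma a * Gamma ((real m - 1) * a) * Gamma (real n + real m * a))"

definition cell_tail :: "nat \<Rightarrow> real \<Rightarrow> nat \<Rightarrow> nat \<Rightarrow> real" where
  "cell_tail j a m n = (\<Sum>l = j + 1..n. cell_prob l a m n)"

definition proper_prior :: "(real \<Rightarrow> real) \<Rightarrow> bool" where
  "proper_prior p \<longleftrightarrow> set_integrable lborel {0<..} p"

end

theory Submission imports Defs
begin

text \<open>Writing the Gamma quotients as Pochhammer symbols, the Chu--Vandermonde identity gives the
  normalisation of the marginal model and the law of a single cell count. Differentiating
  \<open>\<Sum>x p(x | a) = 1\<close> twice turns the Fisher information into the mean of minus the second
  derivative of the log-likelihood, which is \<open>m\<close> times the sum in the reference prior.

  For integrability only the score \<open>S\<close> itself is estimated. Since the counts add up to \<open>n\<close>, the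
  terms of order \<open>1 / a\<close> cancel as \<open>a\<close> tends to infinity, so that \<open>S = O(1 / a\<^sup>2)\<close>. As \<open>a\<close> tends
  to \<open>0\<close>, \<open>S\<^sup>2\<close> is at most \<open>2 m S / a + O(1 / a)\<close>, and \<open>S\<close> has mean \<open>0\<close>. The square root of
  the Fisher information is therefore at most of order \<open>a powr (-1/2)\<close> at \<open>0\<close> and \<open>1 / a\<^sup>2\<close> at
  infinity.\<close>

section \<open>Compositions of \<open>n\<close> and Chu--Vandermonde sums\<close>

text \<open>An arbitrary index set permits induction on finite sets and the removal of any one cell
  without renumbering.\<close>

definition compositions_on :: "'i set \<Rightarrow> nat \<Rightarrow> ('i \<Rightarrow> nat) set" where
  "compositions_on I n = {x \<in> I \<rightarrow>\<^sub>E UNIV. sum x I = n}"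

lemma cell_counts_eq_compositions_on: "cell_counts m n = compositions_on {..<m} n"
  by (simp add: cell_counts_def compositions_on_def)

lemma finite_compositions_on:
  assumes "finite I"
  shows "finite (compositions_on I n)"
proof (rule finite_subset)
  show "compositions_on I n \<subseteq> I \<rightarrow>\<^sub>E {..n}"
    using assms by (auto simp: compositions_on_def PiE_iff extensional_def intro: member_le_sum)
  show "finite (I \<rightarrow>\<^sub>E {..n})"
    using assms by (simp add: finite_PiE)
qed

lemma compositions_on_empty:
  "compositions_on {} n = (if n = 0 then {\<lambda>_. undefined} else {})"
  by (auto simp: compositions_on_def)

lemma sum_compositions_on_insert:
  assumes "finite I" "i \<notin> I"
  shows "(\<Sum>x\<in>compositions_on (insert i I) n. F x)
       = (\<Sum>l\<le>n. \<Sum>y\<in>compositions_on I (n - l). F (y(i := l)))"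
proof -
  have upd: "sum (y(i := l)) I = sum y I" for y :: "'a \<Rightarrow> nat" and l
    using assms by (intro sum.cong) auto
  \<comment> \<open>Resetting the value at \<open>i\<close> to \<open>undefined\<close> makes the
    remainder extensional on \<open>I\<close>, as \<open>compositions_on I\<close> demands.\<close>
  have "(\<Sum>x\<in>compositions_on (insert i I) n. F x)
      = (\<Sum>(l, y)\<in>Sigma {..n} (\<lambda>l. compositions_on I (n - l)). F (y(i := l)))"
  proof (rule sum.reindex_bij_witness[where i = "\<lambda>(l, y). y(i := l)"
          and j = "\<lambda>x. (x i, x(i := undefined))"], goal_cases)
    case (2 x)
    then show ?case
      using assms upd[of x undefined]
      by (auto simp: compositions_on_def PiE_iff extensional_def)
  next
    case (4 z)
    then show ?case
      using assms upd by (auto simp: compositions_on_def PiE_iff extensional_def simp del: fun_upd_apply)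
         (auto simp: fun_upd_apply)
  qed (use assms in \<open>auto simp: compositions_on_def PiE_iff extensional_def fun_eq_iff\<close>)
  also have "\<dots> = (\<Sum>l\<le>n. \<Sum>y\<in>compositions_on I (n - l). F (y(i := l)))"
    using assms(1) by (subst sum.Sigma) (auto simp: finite_compositions_on)
  finally show ?thesis .
qed

text \<open>The weight \<open>h\<close> sees only the cell split off: \<open>h = 1\<close> serves
  the induction for the total mass, a general \<open>h\<close> the law of a single cell.\<close>

lemma sum_compositions_on_insert_prod:
  fixes f h :: "nat \<Rightarrow> 'a::comm_semiring_1"
  assumes "finite I" "i \<notin> I"
  shows "(\<Sum>x\<in>compositions_on (insert i I) n. h (x i) * (\<Prod>k\<in>insert i I. f (x k)))
       = (\<Sum>l\<le>n. h l * (f l * (\<Sum>y\<in>compositions_on I (n - l). \<Prod>k\<in>I. f (y k))))"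
proof -
  have "(\<Prod>k\<in>I. f ((y(i := l)) k)) = (\<Prod>k\<in>I. f (y k))" for y l
    using assms by (intro prod.cong) auto
  then have "(\<Prod>k\<in>insert i I. f ((y(i := l)) k)) = f l * (\<Prod>k\<in>I. f (y k))" for y l
    using assms by (simp del: fun_upd_apply add: fun_upd_same)
  then show ?thesis
    using assms
    by (simp add: sum_compositions_on_insert sum_distrib_left fun_upd_same
        del: fun_upd_apply prod.insert)
qed

text \<open>Chu--Vandermonde divided by \<open>fact n\<close>: the coefficient of t^n in the product
  of the series (1 - t)^(-a) and (1 - t)^(-b).\<close>

lemma pochhammer_fact_binomial_sum:
  fixes a b :: "'a::field_char_0"
  shows "(\<Sum>l\<le>n. pochhammer a l / fact l * (pochhammer b (n - l) / fact (n - l)))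
       = pochhammer (a + b) n / fact n"
  by (auto simp: pochhammer_binomial_sum sum_divide_distrib binomial_fact intro!: sum.cong)

text \<open>Each cell split off convolves with one more factor (1 - t)^(-a) and so adds
  \<open>a\<close> to the parameter.\<close>

lemma sum_compositions_on_pochhammer:
  fixes a :: "'a::field_char_0"
  assumes "finite I"
  shows "(\<Sum>x\<in>compositions_on I n. \<Prod>k\<in>I. pochhammer a (x k) / fact (x k))
       = pochhammer (of_nat (card I) * a) n / fact n"
  using assms
proof (induction I arbitrary: n rule: finite_induct)
  case empty
  then show ?case by (auto simp: compositions_on_empty pochhammer_0_left)
next
  case (insert i I)
  show ?case
    using sum_compositions_on_insert_prod[OF insert.hyps,
        where h = "\<lambda>_. 1" and f = "\<lambda>l. pochhammer a l / fact l" and n = n]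
    using insert.hyps
    by (simp only: insert.IH pochhammer_fact_binomial_sum mult_1) (simp add: algebra_simps)
qed

text \<open>With cell \<open>i\<close> held at \<open>l\<close>, the other \<open>card I - 1\<close>
  cells are summed by \<open>sum_compositions_on_pochhammer\<close>.\<close>

lemma sum_compositions_on_pochhammer_marginal:
  fixes a :: "'a::field_char_0"
  assumes "finite I" "i \<in> I"
  shows "(\<Sum>x\<in>compositions_on I n. h (x i) * (\<Prod>k\<in>I. pochhammer a (x k) / fact (x k)))
       = (\<Sum>l\<le>n. h l * (pochhammer a l / fact l *
            (pochhammer ((of_nat (card I) - 1) * a) (n - l) / fact (n - l))))"
proof -
  define J where "J = I - {i}"
  have J: "finite J" "i \<notin> J" "I = insert i J"
    using assms by (auto simp: J_def)
  show ?thesis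
    unfolding J(3) sum_compositions_on_insert_prod[OF J(1,2), where f = "\<lambda>l. pochhammer a l / fact l"]
    using J(1,2) by (simp add: sum_compositions_on_pochhammer)
qed

section \<open>Pochhammer form of the marginal model and the law of one cell\<close>

lemma Gamma_add_nat_eq_pochhammer:
  fixes a :: real
  assumes "a > 0"
  shows "Gamma (real k + a) = pochhammer a k * Gamma a"
proof -
  have "a \<notin> \<int>\<^sub>\<le>\<^sub>0"
    using assms by (auto elim!: nonpos_Ints_cases)
  then show ?thesis
    using pochhammer_Gamma[of a k] Gamma_real_pos[OF assms] by (simp add: add.commute)
qed

lemma marginal_model_eq_pochhammer:
  assumes "a > 0" "m > 0"
  shows "marginal_model m n x a
       = fact n / pochhammer (real m * a) n * (\<Prod>i<m. pochhammer a (x i) / fact (x i))"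
proof -
  have "real m * a > 0"
    using assms by simp
  moreover from this assms(1) have "Gamma (real m * a) \<noteq> 0" "Gamma a \<noteq> 0"
    by (simp_all add: Gamma_real_pos less_imp_neq[THEN not_sym])
  ultimately show ?thesis
    using assms
    by (simp add: marginal_model_def Gamma_add_nat_eq_pochhammer prod.distrib prod_dividef)
qed

text \<open>This is a beta-binomial law: the remaining cells act as a single one with parameter
  \<open>(real m - 1) * a\<close>.\<close>

lemma cell_prob_eq_pochhammer:
  assumes "a > 0" "m > 1" "l \<le> n"
  shows "cell_prob l a m n = fact n / pochhammer (real m * a) n *
     (pochhammer a l / fact l * (pochhammer ((real m - 1) * a) (n - l) / fact (n - l)))"
proof -
  have pos: "(real m - 1) * a > 0" "real m * a > 0"
    using assms by auto
  with assms(1) have "Gamma a \<noteq> 0" "Gamma ((real m - 1) * a) \<noteq> 0" "Gamma (real m * a) \<noteq> 0"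
    by (simp_all add: Gamma_real_pos less_imp_neq[THEN not_sym])
  moreover have "real n - real l = real (n - l)"
    using assms by simp
  ultimately show ?thesis
    unfolding cell_prob_def using assms pos
    by (simp add: Gamma_add_nat_eq_pochhammer binomial_fact del: of_nat_diff)
qed

lemma sum_marginal_model:
  assumes "a > 0" "m > 0"
  shows "(\<Sum>x\<in>cell_counts m n. marginal_model m n x a) = 1"
proof -
  have "pochhammer (real m * a) n > 0"
    using assms by (auto intro!: pochhammer_pos)
  moreover have "(\<Sum>x\<in>cell_counts m n. marginal_model m n x a) = fact n / pochhammer (real m * a) n *
      (\<Sum>x\<in>compositions_on {..<m} n. \<Prod>k<m. pochhammer a (x k) / fact (x k))"
    using assms unfolding sum_distrib_left cell_counts_eq_compositions_on
    by (simp add: marginal_model_eq_pochhammer)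
  ultimately show ?thesis
    by (simp add: sum_compositions_on_pochhammer)
qed

lemma sum_marginal_model_cell:
  assumes "a > 0" "m > 1" "i < m"
  shows "(\<Sum>x\<in>cell_counts m n. marginal_model m n x a * h (x i)) = (\<Sum>l\<le>n. h l * cell_prob l a m n)"
proof -
  have "(\<Sum>x\<in>cell_counts m n. marginal_model m n x a * h (x i))
      = fact n / pochhammer (real m * a) n *
        (\<Sum>x\<in>compositions_on {..<m} n. h (x i) * (\<Prod>k<m. pochhammer a (x k) / fact (x k)))"
    using assms unfolding sum_distrib_left cell_counts_eq_compositions_on
    by (intro sum.cong) (auto simp: marginal_model_eq_pochhammer)
  also have "\<dots> = (\<Sum>l\<le>n. h l * cell_prob l a m n)"
    using assms
    by (subst sum_compositions_on_pochhammer_marginal)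
       (auto simp: cell_prob_eq_pochhammer sum_distrib_left intro!: sum.cong)
  finally show ?thesis .
qed

text \<open>After interchanging the sums, \<open>g j\<close> is counted exactly when the cell count
  exceeds \<open>j\<close>, so its weight is the right tail at \<open>j\<close>.\<close>

lemma sum_marginal_model_cell_tail:
  assumes "a > 0" "m > 1" "i < m"
  shows "(\<Sum>x\<in>cell_counts m n. marginal_model m n x a * (\<Sum>j<x i. g j))
       = (\<Sum>j<n. g j * cell_tail j a m n)"
proof -
  have "(\<Sum>l\<le>n. (\<Sum>j<l. g j) * cell_prob l a m n)
      = (\<Sum>l\<le>n. \<Sum>j\<in>{j\<in>{..<n}. j < l}. g j * cell_prob l a m n)"
    by (auto simp: sum_distrib_right intro!: sum.cong)
  also have "\<dots> = (\<Sum>j<n. \<Sum>l\<in>{l\<in>{..n}. j < l}. g j * cell_prob l a m n)"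
    by (rule sum.swap_restrict) auto
  also have "\<dots> = (\<Sum>j<n. g j * cell_tail j a m n)"
    unfolding cell_tail_def sum_distrib_left by (intro sum.cong) auto
  finally show ?thesis
    using assms by (simp add: sum_marginal_model_cell[where h = "\<lambda>l. sum g {..<l}"])
qed

section \<open>Derivatives of the likelihood and the Fisher information\<close>

text \<open>The Pochhammer symbols are expanded into finite sums of \<open>ln\<close> terms, so that
  no digamma function enters the derivatives.\<close>

definition log_model :: "nat \<Rightarrow> nat \<Rightarrow> (nat \<Rightarrow> nat) \<Rightarrow> real \<Rightarrow> real" where
  "log_model m n x a = ln (fact n / (\<Prod>i<m. fact (x i)))
     + (\<Sum>i<m. \<Sum>j<x i. ln (a + real j)) - (\<Sum>j<n. ln (real m * a + real j))"

definition score :: "nat \<Rightarrow> nat \<Rightarrow> (nat \<Rightarrow> nat) \<Rightarrow> real \<Rightarrow> real" where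
  "score m n x a = (\<Sum>i<m. \<Sum>j<x i. 1 / (a + real j)) - (\<Sum>j<n. real m / (real m * a + real j))"

text \<open>Minus the derivative of the score in \<open>a\<close>.\<close>

definition observed_information :: "nat \<Rightarrow> nat \<Rightarrow> (nat \<Rightarrow> nat) \<Rightarrow> real \<Rightarrow> real" where
  "observed_information m n x a =
     (\<Sum>i<m. \<Sum>j<x i. 1 / (a + real j)\<^sup>2) - (\<Sum>j<n. (real m)\<^sup>2 / (real m * a + real j)\<^sup>2)"

lemma exp_sum_ln_pochhammer:
  fixes a :: real
  assumes "a > 0"
  shows "exp (\<Sum>j<k. ln (a + real j)) = pochhammer a k"
  using assms by (simp add: exp_sum pochhammer_prod atLeast0LessThan add_pos_nonneg)

lemma marginal_model_eq_exp:
  assumes "a > 0" "m > 0"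
  shows "marginal_model m n x a = exp (log_model m n x a)"
proof -
  have "fact n / (\<Prod>i<m. fact (x i)) > (0::real)"
    by (intro divide_pos_pos prod_pos) auto
  then show ?thesis
    using assms
    by (simp add: marginal_model_eq_pochhammer log_model_def exp_add exp_diff exp_sum[of "{..<m}"]
        exp_sum_ln_pochhammer prod_dividef)
qed

lemma DERIV_log_model:
  assumes "a > 0" "m > 0"
  shows "(log_model m n x has_real_derivative score m n x a) (at a)"
proof -
  have "a + real j > 0" "real m * a + real j > 0" for j
    using assms by (auto intro: add_pos_nonneg)
  then show ?thesis
    unfolding log_model_def[abs_def] score_def
    by (auto intro!: derivative_eq_intros)
qed

lemma DERIV_score:
  assumes "a > 0" "m > 0"
  shows "(score m n x has_real_derivative - observed_information m n x a) (at a)"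
proof -
  have "a + real j > 0" "real m * a + real j > 0" for j
    using assms by (auto intro: add_pos_nonneg)
  then have ne: "a + real j \<noteq> 0" "real m * a + real j \<noteq> 0" for j
    by (metis less_irrefl)+
  show ?thesis
    unfolding score_def[abs_def] observed_information_def
    by (auto intro!: derivative_eq_intros simp: ne power2_eq_square sum_negf)
qed

lemma DERIV_marginal_model:
  assumes "a > 0" "m > 0"
  shows "(marginal_model m n x has_real_derivative marginal_model m n x a * score m n x a) (at a)"
proof (rule has_field_derivative_transform_within_open[where S = "{0<..}"])
  \<comment> \<open>The exponential form is known for positive parameters; an open half-line around
    \<open>a\<close> suffices for the derivative.\<close>
  show "((\<lambda>a. exp (log_model m n x a)) has_real_derivative marginal_model m n x a * score m n x a) (at a)"
    using assms by (auto intro!: derivative_eq_intros DERIV_log_model simp: marginal_model_eq_exp)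
qed (use assms in \<open>auto simp: marginal_model_eq_exp\<close>)

lemma deriv_ln_marginal_model:
  assumes "a > 0" "m > 0"
  shows "deriv (\<lambda>b. ln (marginal_model m n x b)) a = score m n x a"
proof (rule DERIV_imp_deriv, rule has_field_derivative_transform_within_open[where S = "{0<..}"])
  show "(log_model m n x has_real_derivative score m n x a) (at a)"
    using assms by (rule DERIV_log_model)
qed (use assms in \<open>auto simp: marginal_model_eq_exp\<close>)

lemma fisher_information_eq_score:
  assumes "a > 0" "m > 0"
  shows "fisher_information (cell_counts m n) (marginal_model m n) a
       = (\<Sum>x\<in>cell_counts m n. marginal_model m n x a * (score m n x a)\<^sup>2)"
  using assms by (simp add: fisher_information_def deriv_ln_marginal_model)

text \<open>The mean score is the derivative of the total mass, which is constantly 1.\<close>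

lemma sum_marginal_model_score:
  assumes "a > 0" "m > 0"
  shows "(\<Sum>x\<in>cell_counts m n. marginal_model m n x a * score m n x a) = 0"
proof (rule DERIV_unique)
  show "((\<lambda>b. \<Sum>x\<in>cell_counts m n. marginal_model m n x b) has_real_derivative
      (\<Sum>x\<in>cell_counts m n. marginal_model m n x a * score m n x a)) (at a)"
    using assms by (intro DERIV_sum DERIV_marginal_model)
  show "((\<lambda>b. \<Sum>x\<in>cell_counts m n. marginal_model m n x b) has_real_derivative 0) (at a)"
    by (rule has_field_derivative_transform_within_open[where S = "{0<..}" and f = "\<lambda>_. 1"])
       (use assms in \<open>auto simp: sum_marginal_model\<close>)
qed

text \<open>The second Bartlett identity: differentiating the vanishing mean score yields the mean
  of the squared score minus the mean observed information.\<close>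

lemma fisher_information_eq_observed_information:
  assumes "a > 0" "m > 0"
  shows "fisher_information (cell_counts m n) (marginal_model m n) a
       = (\<Sum>x\<in>cell_counts m n. marginal_model m n x a * observed_information m n x a)"
proof -
  have "(\<Sum>x\<in>cell_counts m n. marginal_model m n x a * (score m n x a)\<^sup>2
           - marginal_model m n x a * observed_information m n x a) = 0"
  proof (rule DERIV_unique)
    show "((\<lambda>b. \<Sum>x\<in>cell_counts m n. marginal_model m n x b * score m n x b) has_real_derivative
      (\<Sum>x\<in>cell_counts m n. marginal_model m n x a * (score m n x a)\<^sup>2
           - marginal_model m n x a * observed_information m n x a)) (at a)"
      using assms
      by (auto intro!: derivative_eq_intros DERIV_marginal_model DERIV_score
          simp: power2_eq_square algebra_simps)
    show "((\<lambda>b. \<Sum>x\<in>cell_counts m n. marginal_model m n x b * score m n x b) has_real_derivative 0) (at a)"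
      by (rule has_field_derivative_transform_within_open[where S = "{0<..}" and f = "\<lambda>_. 0"])
         (use assms in \<open>auto simp: sum_marginal_model_score\<close>)
  qed
  then show ?thesis
    using assms by (simp add: fisher_information_eq_score sum_subtractf)
qed

text \<open>All \<open>m\<close> cells have the same law and contribute equally; the part free of
  \<open>x\<close> carries \<open>(real m)\<^sup>2\<close>, so a factor \<open>real m\<close> comes
  out of both.\<close>

lemma fisher_information_eq_cell_tail:
  assumes "a > 0" "m > 1"
  shows "fisher_information (cell_counts m n) (marginal_model m n) a
       = real m * (\<Sum>j<n. cell_tail j a m n / (a + real j)\<^sup>2 - real m / (real m * a + real j)\<^sup>2)"
proof -
  have "(\<Sum>x\<in>cell_counts m n. marginal_model m n x a * (\<Sum>i<m. \<Sum>j<x i. 1 / (a + real j)\<^sup>2))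
      = (\<Sum>i<m. \<Sum>x\<in>cell_counts m n. marginal_model m n x a * (\<Sum>j<x i. 1 / (a + real j)\<^sup>2))"
    unfolding sum_distrib_left[where A = "{..<m}"] by (rule sum.swap)
  also have "\<dots> = real m * (\<Sum>j<n. cell_tail j a m n / (a + real j)\<^sup>2)"
    using assms by (simp add: sum_marginal_model_cell_tail[where g = "\<lambda>j. 1 / (a + real j)\<^sup>2"])
  finally have "fisher_information (cell_counts m n) (marginal_model m n) a
      = real m * (\<Sum>j<n. cell_tail j a m n / (a + real j)\<^sup>2)
        - (\<Sum>j<n. (real m)\<^sup>2 / (real m * a + real j)\<^sup>2)"
    using assms
    by (simp add: fisher_information_eq_observed_information observed_information_def
        right_diff_distrib sum_subtractf sum_marginal_model flip: sum_distrib_right)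
  then show ?thesis
    by (simp add: right_diff_distrib sum_subtractf sum_distrib_left power2_eq_square)
qed

section \<open>Pointwise bounds on the score\<close>

lemma marginal_model_nonneg:
  assumes "a > 0" "m > 0"
  shows "marginal_model m n x a \<ge> 0"
  using assms by (simp add: marginal_model_eq_exp)

lemma cell_count_le:
  assumes "x \<in> cell_counts m n" "i < m"
  shows "x i \<le> n"
  using assms member_le_sum[of i "{..<m}" x] by (auto simp: cell_counts_def)

lemma sum_cell_counts:
  assumes "x \<in> cell_counts m n"
  shows "(\<Sum>i<m. real (x i)) = real n"
  using assms by (auto simp: cell_counts_def simp flip: of_nat_sum)

text \<open>Both parts of the score have leading behaviour \<open>real n / a\<close>. Subtracting
  \<open>1 / a\<close> from every term leaves two gaps \<open>A\<close> and \<open>B\<close> in the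
  same interval from 0 to \<open>real n * d\<close>, and the score is their difference.\<close>

lemma abs_score_le:
  assumes "a > 0" "m > 0" "x \<in> cell_counts m n"
  shows "\<bar>score m n x a\<bar> \<le> (real n)\<^sup>2 / a\<^sup>2"
proof -
  define d where "d = real n / a\<^sup>2"
  define A where "A = (\<Sum>i<m. \<Sum>j<x i. 1 / a - 1 / (a + real j))"
  define B where "B = (\<Sum>j<n. 1 / a - real m / (real m * a + real j))"
  \<comment> \<open>Used with \<open>c = 1\<close> for the cell terms and with
    \<open>c = real m\<close> for the terms of the total.\<close>
  have gap: "0 \<le> 1 / a - c / (c * a + real j) \<and> 1 / a - c / (c * a + real j) \<le> d"
    if "j < n" "c \<ge> 1" for j and c :: real
  proof -
    have pos: "c * a + real j > 0"
      using that assms by (intro add_pos_nonneg) auto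
    then have eq: "1 / a - c / (c * a + real j) = real j / (a * (c * a + real j))"
      using assms(1) by (simp add: field_simps)
    have "1 * a \<le> c * a"
      using that assms(1) by (intro mult_right_mono) auto
    then have "a \<le> c * a + real j"
      by simp
    then have "a * a \<le> a * (c * a + real j)"
      using assms(1) by (intro mult_left_mono) auto
    then have "real j / (a * (c * a + real j)) \<le> d"
      unfolding d_def power2_eq_square using that assms(1) by (intro frac_le) auto
    then show ?thesis
      unfolding eq using pos assms(1) by simp
  qed
  have x: "x i \<le> n" if "i < m" for i
    using assms(3) that by (rule cell_count_le)
  have "(\<Sum>i<m. \<Sum>j<x i. 1 / a) = real n / a"
    using sum_cell_counts[OF assms(3)] by (simp flip: sum_divide_distrib)
  then have S: "score m n x a = B - A"
    by (simp add: score_def A_def B_def sum_subtractf)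
  have A: "0 \<le> A"
    unfolding A_def using x gap[of _ 1] by (intro sum_nonneg) force
  have "A \<le> (\<Sum>i<m. \<Sum>j<x i. d)"
    unfolding A_def using x gap[of _ 1] by (intro sum_mono) force
  also have "\<dots> = real n * d"
    using sum_cell_counts[OF assms(3)] by (simp flip: sum_distrib_right)
  finally have A': "A \<le> real n * d" .
  have B: "0 \<le> B"
    unfolding B_def using gap[of _ "real m"] assms by (intro sum_nonneg) auto
  have "B \<le> (\<Sum>j<n. d)"
    unfolding B_def using gap[of _ "real m"] assms by (intro sum_mono) auto
  then have B': "B \<le> real n * d"
    by simp
  have "real n * d = (real n)\<^sup>2 / a\<^sup>2"
    by (simp add: d_def power2_eq_square)
  then show ?thesis
    using S A A' B B' by linarith
qed

text \<open>With \<open>K\<close> the number of nonempty cells, the \<open>j = 0\<close> terms of the score add up to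
  \<open>(K - 1) / a\<close> and the others stay bounded as \<open>a\<close> tends to \<open>0\<close>. Since
  \<open>0 \<le> K - 1 \<le> m\<close>, one factor of \<open>((K - 1) / a)\<^sup>2\<close> can be replaced by \<open>m / a\<close>. The bound
  is left linear in the score because the score has mean \<open>0\<close>.\<close>

lemma score_square_le:
  assumes "a > 0" "m > 0" "x \<in> cell_counts m n"
  shows "(score m n x a)\<^sup>2 \<le> 2 * real m / a * score m n x a
    + 2 * (real m)\<^sup>2 * real n / a + 2 * (real m)\<^sup>2 * (real n)\<^sup>2"
proof (cases "n = 0")
  \<comment> \<open>Without observations \<open>K - 1\<close> would be -1, so this case is
    separated; the score is then 0.\<close>
  case True
  then have "score m n x a = 0"
    using abs_score_le[OF assms] by simp
  then show ?thesis
    using True by simp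
next
  case False
  define K where "K = (\<Sum>i<m. of_bool (x i > 0) :: real)"
  define A where "A = (\<Sum>i<m. \<Sum>j = 1..<x i. 1 / (a + real j))"
  define B where "B = (\<Sum>j = 1..<n. real m / (real m * a + real j))"
  \<comment> \<open>An empty cell has no \<open>j = 0\<close> term, so these terms count exactly the
    nonempty cells.\<close>
  have head: "(\<Sum>j<k. f j) = of_bool (k > 0) * f 0 + (\<Sum>j = 1..<k. f j)" for k and f :: "nat \<Rightarrow> real"
    by (cases k) (simp_all add: sum.atLeast_Suc_lessThan flip: atLeast0LessThan)
  have S: "score m n x a = (K - 1) / a + (A - B)"
  proof -
    have "(\<Sum>i<m. \<Sum>j<x i. 1 / (a + real j)) = K / a + A"
      unfolding K_def A_def sum_divide_distrib sum.distrib[symmetric]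
      by (intro sum.cong refl) (simp add: head[of _ "x _"])
    moreover have "(\<Sum>j<n. real m / (real m * a + real j)) = 1 / a + B"
      unfolding B_def using False assms by (simp add: head)
    ultimately show ?thesis
      by (simp add: score_def diff_divide_distrib)
  qed
  \<comment> \<open>For \<open>j \<ge> 1\<close> the denominator stays above 1 however small
    \<open>a\<close> is, which keeps \<open>A\<close> and \<open>B\<close> bounded near 0.\<close>
  have tail: "0 \<le> c / (c * a + real j) \<and> c / (c * a + real j) \<le> c" if "j \<ge> 1" "c > 0" for j and c :: real
  proof -
    have "c * a > 0"
      using that assms(1) by simp
    then have "c * a + real j \<ge> 1"
      using that by linarith
    then show ?thesis
      using that by (auto simp: divide_le_eq)
  qed
  have "A \<le> (\<Sum>i<m. \<Sum>j = 1..<x i. 1)"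
    unfolding A_def using tail[of _ 1] by (intro sum_mono) force
  also have "\<dots> \<le> (\<Sum>i<m. real (x i))"
    by (intro sum_mono) auto
  finally have "A \<le> real n"
    using sum_cell_counts[OF assms(3)] by simp
  \<comment> \<open>Weakened to the bound that also holds for \<open>B\<close>, so that it bounds
    the absolute difference.\<close>
  also have "real n \<le> real m * real n"
    using assms(2) mult_right_mono[of 1 "real m" "real n"] by simp
  finally have A': "A \<le> real m * real n" .
  have A: "0 \<le> A"
    unfolding A_def using assms(1) by (intro sum_nonneg) auto
  have B: "0 \<le> B"
    unfolding B_def using assms(1) by (intro sum_nonneg) auto
  have "B \<le> (\<Sum>j = 1..<n. real m)"
    unfolding B_def using tail[of _ "real m"] assms(2) by (intro sum_mono) auto
  also have "\<dots> \<le> real m * real n"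
    using mult_right_mono[of "real (n - 1)" "real n" "real m"] by (simp add: mult.commute)
  finally have AB: "\<bar>A - B\<bar> \<le> real m * real n"
    using A A' B by linarith
  have "\<exists>i<m. x i > 0"
  proof (rule ccontr)
    assume "\<not> ?thesis"
    then show False
      using assms(3) False by (auto simp: cell_counts_def)
  qed
  then obtain i where "i < m" "x i > 0"
    by blast
  then have K1: "1 \<le> K"
    unfolding K_def using member_le_sum[of i "{..<m}" "\<lambda>i. of_bool (x i > 0) :: real"] by simp
  have "K \<le> (\<Sum>i<m. 1)"
    unfolding K_def by (intro sum_mono) auto
  then have Km: "K - 1 \<le> real m"
    by simp
  have "((K - 1) / a)\<^sup>2 \<le> real m / a * ((K - 1) / a)"
    unfolding power2_eq_square using K1 Km assms(1) by (intro mult_right_mono divide_right_mono) auto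
  also have "\<dots> = real m / a * score m n x a + real m / a * (B - A)"
    unfolding distrib_left[symmetric] S by simp
  also have "\<dots> \<le> real m / a * score m n x a + real m / a * (real m * real n)"
    using AB assms(1) by (intro add_left_mono mult_left_mono) auto
  finally have 1: "((K - 1) / a)\<^sup>2 \<le> real m / a * score m n x a + real m / a * (real m * real n)" .
  have 2: "(A - B)\<^sup>2 \<le> (real m * real n)\<^sup>2"
    using AB by (simp flip: abs_le_square_iff)
  have "(score m n x a)\<^sup>2 \<le> 2 * ((K - 1) / a)\<^sup>2 + 2 * (A - B)\<^sup>2"
    unfolding S using sum_squares_bound[of "(K - 1) / a" "A - B"] by (simp add: power2_sum)
  also have "\<dots> \<le> 2 * (real m / a * score m n x a + real m / a * (real m * real n))
      + 2 * (real m * real n)\<^sup>2"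
    using 1 2 by (intro add_mono mult_left_mono) auto
  finally show ?thesis
    by (simp add: power_mult_distrib power2_eq_square distrib_left mult_ac)
qed

section \<open>Bounds on the root of the Fisher information and integrability\<close>

lemma sqrt_fisher_information_le_large:
  assumes "a > 0" "m > 0"
  shows "sqrt (fisher_information (cell_counts m n) (marginal_model m n) a) \<le> (real n)\<^sup>2 / a\<^sup>2"
proof (rule real_le_lsqrt)
  have "fisher_information (cell_counts m n) (marginal_model m n) a
      \<le> (\<Sum>x\<in>cell_counts m n. marginal_model m n x a * ((real n)\<^sup>2 / a\<^sup>2)\<^sup>2)"
    unfolding fisher_information_eq_score[OF assms]
  proof (intro sum_mono mult_left_mono)
    fix x assume "x \<in> cell_counts m n"
    from abs_score_le[OF assms this] show "(score m n x a)\<^sup>2 \<le> ((real n)\<^sup>2 / a\<^sup>2)\<^sup>2"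
      by (simp add: abs_le_square_iff[symmetric])
  qed (use assms in \<open>auto simp: marginal_model_nonneg\<close>)
  also have "\<dots> = ((real n)\<^sup>2 / a\<^sup>2)\<^sup>2"
    using assms by (simp add: sum_marginal_model flip: sum_distrib_right)
  finally show "fisher_information (cell_counts m n) (marginal_model m n) a \<le> ((real n)\<^sup>2 / a\<^sup>2)\<^sup>2" .
qed auto

text \<open>Averaging the bound of \<open>score_square_le\<close> removes its linear term, leaving a
  constant of order \<open>1 / a\<close>.\<close>

lemma sqrt_fisher_information_le_small:
  assumes "0 < a" "a \<le> 1" "m > 0"
  shows "sqrt (fisher_information (cell_counts m n) (marginal_model m n) a)
      \<le> 2 * real m * real n * a powr (-1/2)"
proof (rule real_le_lsqrt)
  define C where "C = 2 * (real m)\<^sup>2 * real n / a + 2 * (real m)\<^sup>2 * (real n)\<^sup>2"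
  have "fisher_information (cell_counts m n) (marginal_model m n) a
      \<le> (\<Sum>x\<in>cell_counts m n. marginal_model m n x a * (2 * real m / a * score m n x a + C))"
    unfolding fisher_information_eq_score[OF assms(1,3)]
  proof (intro sum_mono mult_left_mono)
    fix x assume "x \<in> cell_counts m n"
    from score_square_le[OF assms(1,3) this]
    show "(score m n x a)\<^sup>2 \<le> 2 * real m / a * score m n x a + C"
      by (simp add: C_def)
  qed (use assms in \<open>auto simp: marginal_model_nonneg\<close>)
  also have "\<dots> = 2 * real m / a * (\<Sum>x\<in>cell_counts m n. marginal_model m n x a * score m n x a)
      + C * (\<Sum>x\<in>cell_counts m n. marginal_model m n x a)"
    by (simp add: sum_distrib_left sum.distrib algebra_simps)
  also have "\<dots> = C"
    using assms by (simp add: sum_marginal_model sum_marginal_model_score)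
  \<comment> \<open>Both summands of \<open>C\<close> are brought to the same form, the first by
    \<open>n \<le> n\<^sup>2\<close>, the second by \<open>a \<le> 1\<close>.\<close>
  also have "C \<le> 4 * (real m)\<^sup>2 * (real n)\<^sup>2 / a"
  proof -
    have "real n \<le> (real n)\<^sup>2"
      by (cases n) (auto simp: power2_eq_square)
    then have "2 * (real m)\<^sup>2 * real n / a \<le> 2 * (real m)\<^sup>2 * (real n)\<^sup>2 / a"
      using assms by (intro divide_right_mono mult_left_mono) auto
    moreover have "2 * (real m)\<^sup>2 * (real n)\<^sup>2 * a \<le> 2 * (real m)\<^sup>2 * (real n)\<^sup>2 * 1"
      using assms by (intro mult_left_mono) auto
    then have "2 * (real m)\<^sup>2 * (real n)\<^sup>2 \<le> 2 * (real m)\<^sup>2 * (real n)\<^sup>2 / a"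
      using assms by (simp add: le_divide_eq)
    ultimately show ?thesis
      by (simp add: C_def)
  qed
  also have "\<dots> = (2 * real m * real n * a powr (-1/2))\<^sup>2"
  proof -
    have "(a powr (-1/2))\<^sup>2 = 1 / a"
      using assms by (simp add: power2_eq_square powr_minus_divide flip: powr_add)
    then show ?thesis
      by (simp add: power_mult_distrib)
  qed
  finally show "fisher_information (cell_counts m n) (marginal_model m n) a
      \<le> (2 * real m * real n * a powr (-1/2))\<^sup>2" .
qed auto

lemma set_integrable_sqrt_fisher_information:
  assumes "m > 0"
  shows "set_integrable lborel {0<..}
    (\<lambda>a. sqrt (fisher_information (cell_counts m n) (marginal_model m n) a))"
proof -
  define F where "F = (\<lambda>a. sqrt (fisher_information (cell_counts m n) (marginal_model m n) a))"
  \<comment> \<open>\<open>G\<close> agrees with \<open>F\<close> on the half-line and is visibly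
    Borel measurable, being built from elementary functions without \<open>deriv\<close>.\<close>
  define G where "G = (\<lambda>a. sqrt (\<Sum>x\<in>cell_counts m n. exp (log_model m n x a) * (score m n x a)\<^sup>2))"
  have FG: "F a = G a" if "a > 0" for a
    using that assms by (simp add: F_def G_def fisher_information_eq_score marginal_model_eq_exp)
  have G: "G \<in> borel_measurable borel"
    unfolding G_def log_model_def score_def by measurable
  have nonneg: "G a \<ge> 0" for a
    by (auto simp: G_def intro!: sum_nonneg)
  \<comment> \<open>Comparison test: a nonnegative gauge-integrable \<open>f\<close> is absolutely
    integrable, and its Borel measurability brings this from \<open>lebesgue\<close> down to
    \<open>lborel\<close>.\<close>
  have int: "set_integrable lborel A G"
    if "f integrable_on A" "A \<in> sets borel" "f \<in> borel_measurable borel"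
      "\<And>a. a \<in> A \<Longrightarrow> 0 \<le> f a" "\<And>a. a \<in> A \<Longrightarrow> G a \<le> C * f a" for f C A
  proof (rule set_integrable_bound)
    have "set_integrable lebesgue A f"
      using that by (intro nonnegative_absolutely_integrable_1) auto
    then have "set_integrable lborel A f"
      unfolding set_integrable_def using that by (subst (asm) integrable_completion) auto
    then show "set_integrable lborel A (\<lambda>a. C * f a)"
      by (intro set_integrable_mult_right)
    show "AE a in lborel. a \<in> A \<longrightarrow> norm (G a) \<le> norm (C * f a)"
      using that(5) nonneg by (auto intro: order_trans[OF _ abs_ge_self])
  qed (use G that(2) in \<open>auto simp: set_borel_measurable_def\<close>)
  have "set_integrable lborel {0<..1} G"
  proof (rule int)
    show "(\<lambda>a. a powr (-1/2)) integrable_on {0<..(1::real)}"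
      by (rule integrable_on_powr_from_0') auto
    show "G a \<le> 2 * real m * real n * a powr (-1/2)" if "a \<in> {0<..1}" for a
      using that sqrt_fisher_information_le_small[of a m n] assms FG[of a] by (simp add: F_def)
  qed auto
  moreover have "set_integrable lborel {1..} G"
  proof (rule int)
    show "(\<lambda>a. a powr (-2)) integrable_on {(1::real)..}"
      using has_integral_powr_to_inf[of "-2" 1] by (auto simp: integrable_on_def)
    show "G a \<le> (real n)\<^sup>2 * a powr (-2)" if "a \<in> {1..}" for a
      using that sqrt_fisher_information_le_large[of a m n] assms FG[of a]
      by (simp add: F_def powr_minus_divide)
  qed auto
  ultimately have "set_integrable lborel ({0<..1} \<union> {1..}) G"
    by (rule set_integrable_Un) auto
  also have "{0<..1} \<union> {1..} = {0::real<..}"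
    by auto
  also have "set_integrable lborel {0<..} G \<longleftrightarrow> set_integrable lborel {0<..} F"
    by (intro set_integrable_cong) (auto simp: FG)
  finally show ?thesis
    unfolding F_def .
qed

theorem proposition4p2:
  fixes m n :: nat and piR :: "real \<Rightarrow> real"
  assumes "m > 1"
    and "jeffreys_prior m n piR"
  shows "proportional_prior piR
           (\<lambda>a. sqrt (\<Sum>j<n. cell_tail j a m n / (a + real j)\<^sup>2
                                  - real m / (real m * a + real j)\<^sup>2))
         \<and> proper_prior piR"
proof
  obtain c where c: "c > 0"
    "\<And>a. a > 0 \<Longrightarrow> piR a = c * sqrt (fisher_information (cell_counts m n) (marginal_model m n) a)"
    using assms(2) by (auto simp: jeffreys_prior_def proportional_prior_def)
  \<comment> \<open>The Fisher information is \<open>real m\<close> times the bracketed sum, so the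
    constant gains a factor \<open>sqrt (real m)\<close>.\<close>
  show "proportional_prior piR
           (\<lambda>a. sqrt (\<Sum>j<n. cell_tail j a m n / (a + real j)\<^sup>2
                                  - real m / (real m * a + real j)\<^sup>2))"
    unfolding proportional_prior_def
    using c assms(1)
    by (intro exI[of _ "c * sqrt (real m)"]) (auto simp: fisher_information_eq_cell_tail real_sqrt_mult)
  have "set_integrable lborel {0<..}
      (\<lambda>a. c * sqrt (fisher_information (cell_counts m n) (marginal_model m n) a))"
    using assms(1) by (intro set_integrable_mult_right set_integrable_sqrt_fisher_information) auto
  also have "?this \<longleftrightarrow> set_integrable lborel {0<..} piR"
    using c(2) by (intro set_integrable_cong) auto
  finally show "proper_prior piR"
    unfolding proper_prior_def .
qed

end
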